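(* Let $s,t,k$ be integers with $t\ge s\ge 2$ and $0\le k\le \lfloor s/2\rfloor-1$. For all sufficiently large $n$: (i) $r(K_{n,n},K_{s,t},st-k)=n^2-k$; (ii) $r\!\left(K_{n,n},K_{s,t},st-\lfloor s/2\rfloor\right)\le n^2-\lfloor n/2\rfloor$; (iii) if $s\ge 7$ is odd, then $r\!\left(K_{n,n},K_{s,t},st-\lfloor s/2\rfloor\right)=n^2-\lfloor n/2\rfloor$; (iv) if $s\ge 14$ is even, then $r\!\left(K_{n,n},K_{s,t},st-\lfloor s/2\rfloor\right)=n^2-\lceil n/2\rceil$.
   Context: For graphs $G,H$ and an integer $q$ with $2\le q\le |E(H)|$, an $(H,q)$-coloring of $G$ is an edge-coloring of $G$ in which every subgraph of $G$ isomorphic to $H$ receives at least $q$ distinct colors; $r(G,H,q)$ is the minimum number of colors needed for $G$ to have an $(H,q)$-coloring. $K_{n,n}$, $K_{s,t}$ denote complete bipartite graphs. *)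

theory Defs
  imports Complex_Main
begin

text \<open>A simple graph is a pair of its vertex set and its edge set, the edges being two-element
  sets of vertices.\<close>

type_synonym 'a ugraph = "'a set \<times> 'a set set"

abbreviation verts :: "'a ugraph \<Rightarrow> 'a set" where
  "verts G \<equiv> fst G"

abbreviation edges :: "'a ugraph \<Rightarrow> 'a set set" where
  "edges G \<equiv> snd G"

definition simple_graph :: "'a ugraph \<Rightarrow> bool" where
  "simple_graph G \<longleftrightarrow> finite (verts G) \<and> edges G \<subseteq> {e. e \<subseteq> verts G \<and> card e = 2}"

definition subgraph :: "'a ugraph \<Rightarrow> 'a ugraph \<Rightarrow> bool" where
  "subgraph F G \<longleftrightarrow> simple_graph F \<and> verts F \<subseteq> verts G \<and> edges F \<subseteq> edges G"

definition graph_iso :: "'a ugraph \<Rightarrow> 'b ugraph \<Rightarrow> bool" where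
  "graph_iso F H \<longleftrightarrow> (\<exists>\<phi>. bij_betw \<phi> (verts F) (verts H) \<and> edges H = (\<lambda>e. \<phi> ` e) ` edges F)"

definition complete_bipartite :: "nat \<Rightarrow> nat \<Rightarrow> (nat + nat) ugraph" where
  "complete_bipartite a b =
     (Inl ` {..<a} \<union> Inr ` {..<b}, {{Inl i, Inr j} | i j. i < a \<and> j < b})"

text \<open>Edge-colorings need not be proper. A coloring is a function on all vertex sets, but only its
  values on edges matter.\<close>

definition Hq_coloring :: "'a ugraph \<Rightarrow> 'b ugraph \<Rightarrow> nat \<Rightarrow> ('a set \<Rightarrow> 'c) \<Rightarrow> bool" where
  "Hq_coloring G H q f \<longleftrightarrow>
     (\<forall>F. subgraph F G \<and> graph_iso F H \<longrightarrow> q \<le> card (f ` edges F))"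

definition Hq_number :: "'a ugraph \<Rightarrow> 'b ugraph \<Rightarrow> nat \<Rightarrow> nat" where
  "Hq_number G H q =
     (LEAST c. \<exists>f :: 'a set \<Rightarrow> nat. f ` edges G \<subseteq> {..<c} \<and> Hq_coloring G H q f)"

text \<open>The minimum is over a nonempty set whenever \<open>q\<close> does not exceed the number of edges of \<open>H\<close>,
  since a coloring giving all edges different colors is then admissible.\<close>

lemma Hq_number_attained:
  assumes "simple_graph G" and "q \<le> card (edges H)"
  shows "\<exists>f :: 'a set \<Rightarrow> nat. f ` edges G \<subseteq> {..<Hq_number G H q} \<and> Hq_coloring G H q f"
proof -
  have "edges G \<subseteq> Pow (verts G)" and "finite (verts G)"
    using assms(1) by (auto simp: simple_graph_def)
  then have fin: "finite (edges G)"
    by (meson finite_Pow_iff finite_subset)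
  then obtain f :: "'a set \<Rightarrow> nat" where inj: "inj_on f (edges G)"
    using finite_imp_inj_to_nat_seg by metis
  obtain c where c: "f ` edges G \<subseteq> {..<c}"
    using fin finite_nat_set_iff_bounded[of "f ` edges G"] by auto
  have "q \<le> card (f ` edges F)" if F: "subgraph F G" "graph_iso F H" for F
  proof -
    have sub: "edges F \<subseteq> edges G" using F(1) by (simp add: subgraph_def)
    obtain \<phi> where "edges H = (\<lambda>e. \<phi> ` e) ` edges F"
      using F(2) by (auto simp: graph_iso_def)
    then have "card (edges H) \<le> card (edges F)"
      using card_image_le finite_subset[OF sub fin] by metis
    also have "\<dots> = card (f ` edges F)"
      using inj_on_subset[OF inj sub] by (simp add: card_image)
    finally show ?thesis using assms(2) by simp
  qed
  then have "\<exists>f :: 'a set \<Rightarrow> nat. f ` edges G \<subseteq> {..<c} \<and> Hq_coloring G H q f"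
    using c unfolding Hq_coloring_def by blast
  then show ?thesis
    unfolding Hq_number_def by (rule LeastI)
qed

end

theory Submission imports Defs
begin

text \<open>The excess of an edge set is the number of its edges minus the number of its colors. Any edge
  set can be extended, by at most two edges per step, so that its excess grows by exactly one; hence
  excess \<open>e\<close> is reached within \<open>2 e\<close> vertices on each side. To reach it within
  \<open>2 e - d\<close> vertices, where \<open>d = 1\<close> for odd \<open>s\<close> and \<open>d = 2\<close> for even \<open>s\<close>,
  it suffices to start the extension from a set of small excess whose vertices on each side number at
  most twice its excess minus \<open>d\<close>. If the whole coloring has twice its excess at least
  \<open>n + d\<close>, such a set exists: either from color classes with at least three edges, or from
  repeatedly colored edges that share vertices, as there are more of these than there are vertices.

  The extremal colorings identify diagonal edges in pairs (and one triple if \<open>s\<close> is even and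
  \<open>n\<close> is odd); a copy of \<open>K\<^bsub>s,t\<^esub>\<close> contains at most \<open>s\<close> diagonal edges.\<close>

section \<open>Excess of a set under a coloring, and how it grows\<close>

definition excess :: "('a \<Rightarrow> 'b) \<Rightarrow> 'a set \<Rightarrow> nat" where
  "excess f X = card X - card (f ` X)"

lemma card_image_plus_excess: "finite X \<Longrightarrow> card (f ` X) + excess f X = card X"
  by (simp add: excess_def card_image_le)

text \<open>Each added element brings at most one new value. Besides colorings, \<open>f\<close>
  will be a vertex projection, so this also bounds the number of newly met vertices.\<close>

lemma card_image_le_superset:
  assumes "finite Y" "X \<subseteq> Y"
  shows "card (f ` Y) + card X \<le> card (f ` X) + card Y"
proof -
  have "f ` Y = f ` X \<union> f ` (Y - X)" using assms by blast
  then have "card (f ` Y) \<le> card (f ` X) + card (f ` (Y - X))"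
    by (simp add: card_Un_le)
  moreover have "card (f ` (Y - X)) \<le> card (Y - X)"
    using assms by (simp add: card_image_le)
  moreover have "card (Y - X) + card X = card Y"
    using assms by (metis card_Diff_subset card_mono finite_subset le_add_diff_inverse2)
  ultimately show ?thesis by linarith
qed

lemma excess_mono:
  assumes "finite Y" "X \<subseteq> Y"
  shows "excess f X \<le> excess f Y"
  using card_image_le_superset[OF assms, of f] by (simp add: excess_def)

text \<open>If no outside element repeats a color of \<open>X\<close>, the colors inside and outside
  are disjoint, so the missing excess must come from two outside elements of equal color.\<close>

lemma excess_extend_one:
  assumes fin: "finite E" and X: "X \<subseteq> E" and less: "excess f X < excess f E"
  shows "\<exists>X'. X \<subseteq> X' \<and> X' \<subseteq> E \<and> excess f X' = Suc (excess f X) \<and> card X' \<le> card X + 2"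
proof -
  have finX: "finite X" using fin X finite_subset by blast
  show ?thesis
  proof (cases "\<exists>y\<in>E - X. f y \<in> f ` X")
    case True
    then obtain y where y: "y \<in> E" "y \<notin> X" "f y \<in> f ` X" by blast
    then have "excess f (insert y X) = Suc (excess f X)"
      using finX card_image_plus_excess[OF finX, of f] by (simp add: excess_def insert_absorb)
    then show ?thesis using X y finX by (intro exI[of _ "insert y X"]) auto
  next
    case False
    have "\<not> inj_on f (E - X)"
    proof
      assume inj: "inj_on f (E - X)"
      have "f ` E = f ` X \<union> f ` (E - X)" using X by blast
      moreover have "f ` (E - X) \<inter> f ` X = {}"
        unfolding disjoint_eq_subset_Compl using False by (intro image_subsetI) simp
      ultimately have "card (f ` E) = card (f ` X) + card (E - X)"
        using fin finX inj by (simp add: card_Un_disjoint card_image Int_commute)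
      moreover have "card (E - X) + card X = card E"
        using fin X by (metis card_Diff_subset card_mono finX le_add_diff_inverse2)
      ultimately show False using less by (simp add: excess_def)
    qed
    then obtain y z where yz: "y \<in> E - X" "z \<in> E - X" "y \<noteq> z" "f y = f z"
      by (auto simp: inj_on_def)
    then have "f z \<notin> f ` X" using False by blast
    then have "excess f (insert y (insert z X)) = Suc (excess f X)"
      using finX yz card_image_plus_excess[OF finX, of f] by (auto simp: excess_def)
    then show ?thesis using X yz finX
      by (intro exI[of _ "insert y (insert z X)"]) auto
  qed
qed

text \<open>Unit steps of excess cost at most two elements each; the cost bound is written without
  subtraction.\<close>

lemma excess_extend:
  assumes fin: "finite E" and X: "X \<subseteq> E" and le: "excess f X \<le> e" "e \<le> excess f E"
  shows "\<exists>X'. X \<subseteq> X' \<and> X' \<subseteq> E \<and> excess f X' = e \<and> card X' + 2 * excess f X \<le> card X + 2 * e"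
  using le
proof (induction e rule: dec_induct)
  case base
  then show ?case using X by blast
next
  case (step e)
  then obtain Y where Y: "X \<subseteq> Y" "Y \<subseteq> E" "excess f Y = e"
    "card Y + 2 * excess f X \<le> card X + 2 * e"
    by auto
  then obtain Y' where "Y \<subseteq> Y'" "Y' \<subseteq> E" "excess f Y' = Suc e" "card Y' \<le> card Y + 2"
    using excess_extend_one[OF fin Y(2), of f] step by auto
  then show ?case using Y by (intro exI[of _ Y']) auto
qed

lemma excess_subset:
  assumes "finite E" "e \<le> excess f E"
  shows "\<exists>X \<subseteq> E. excess f X = e \<and> card X \<le> 2 * e"
  using excess_extend[of E "{}" f e] assms by (auto simp: excess_def)

section \<open>Seeds of small excess that meet few vertices\<close>

lemma card_eq_sum_fibres:
  assumes "finite A"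
  shows "card A = (\<Sum>c\<in>f ` A. card {x \<in> A. f x = c})"
  using sum.image_gen[OF assms, of "\<lambda>_. 1::nat" f] by simp

text \<open>A smallest set satisfying the hypothesis takes at least three elements from every class that
  it meets, since dropping a class of at most two elements preserves the hypothesis.\<close>

lemma dense_subset_small_excess:
  assumes "finite Z" and "2 * card (f ` Z) + d \<le> card Z"
  shows "\<exists>X \<subseteq> Z. card X = 2 * card (f ` X) + d \<and> excess f X \<le> 2 * d"
  using assms
proof (induction Z rule: finite_psubset_induct)
  case (psubset Z)
  have shrink: ?case if "Y \<subset> Z" "2 * card (f ` Y) + d \<le> card Y" for Y
    using psubset.IH[OF that] that(1) by blast
  show ?case
  proof (cases "card Z = 2 * card (f ` Z) + d")
    case False
    then obtain z where z: "z \<in> Z" using psubset.prems by fastforce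
    have "card (f ` (Z - {z})) \<le> card (f ` Z)"
      using psubset.hyps by (intro card_mono) auto
    moreover have "card (Z - {z}) = card Z - 1" using z psubset.hyps by simp
    ultimately show ?thesis
      using z False psubset.prems by (intro shrink[of "Z - {z}"]) auto
  next
    case eq: True
    show ?thesis
    proof (cases "\<exists>z\<in>Z. card {x \<in> Z. f x = f z} \<le> 2")
      case True
      then obtain z where z: "z \<in> Z" "card {x \<in> Z. f x = f z} \<le> 2" by blast
      define Y where "Y = Z - {x \<in> Z. f x = f z}"
      have "f ` Y = f ` Z - {f z}" unfolding Y_def by auto
      then have "card (f ` Y) + 1 = card (f ` Z)"
        using z psubset.hyps by (metis Suc_eq_plus1 card.remove finite_imageI image_eqI)
      moreover have "card Y = card Z - card {x \<in> Z. f x = f z}"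
        unfolding Y_def using psubset.hyps by (intro card_Diff_subset) auto
      ultimately have "2 * card (f ` Y) + d \<le> card Y" using z eq by linarith
      moreover have "Y \<subset> Z" using z unfolding Y_def by blast
      ultimately show ?thesis by (rule shrink[rotated])
    next
      case False
      have "card Z = (\<Sum>c\<in>f ` Z. card {x \<in> Z. f x = c})"
        using psubset.hyps by (rule card_eq_sum_fibres)
      also have "\<dots> \<ge> (\<Sum>c\<in>f ` Z. 3)"
        using False by (intro sum_mono) auto
      finally have "3 * card (f ` Z) \<le> card Z" by simp
      \<comment> \<open>With \<open>c\<close> colors, \<open>3 * c \<le> 2 * c + d\<close> gives
        \<open>c \<le> d\<close>, and the excess is \<open>c + d\<close>.\<close>
      then have "excess f Z \<le> 2 * d" using eq by (simp add: excess_def)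
      then show ?thesis using eq by blast
    qed
  qed
qed

text \<open>An element of an old color is added alone, one of a new color together with a partner of
  the same color. Neither move lowers the size minus twice the number of colors, and each raises the
  excess by one.\<close>

lemma absorb_repeated:
  assumes fin: "finite E" and Z: "Z \<subseteq> E" and finW: "finite W"
    and W: "W \<subseteq> {x \<in> E. \<exists>y\<in>E. y \<noteq> x \<and> f y = f x}"
  shows "\<exists>X. Z \<union> W \<subseteq> X \<and> X \<subseteq> E \<and> 2 * card (f ` X) + card Z \<le> card X + 2 * card (f ` Z)
    \<and> excess f X \<le> excess f Z + card W"
  using finW W
proof (induction W rule: finite_induct)
  case empty
  then show ?case using Z by (intro exI[of _ Z]) auto
next
  case (insert w W)
  then obtain X where X: "Z \<union> W \<subseteq> X" "X \<subseteq> E"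
      "2 * card (f ` X) + card Z \<le> card X + 2 * card (f ` Z)"
      "excess f X \<le> excess f Z + card W"
    by auto
  have finX: "finite X" using X(2) fin finite_subset by blast
  obtain w' where w: "w \<in> E" "w' \<in> E" "w' \<noteq> w" "f w' = f w" using insert.prems by auto
  consider "w \<in> X" | "w \<notin> X" "f w \<in> f ` X" | "w \<notin> X" "f w \<notin> f ` X" by blast
  then show ?case
  proof cases
    case 1
    then show ?thesis using X insert.hyps by (intro exI[of _ X]) auto
  next
    case 2
    then have "f ` insert w X = f ` X" "card (insert w X) = Suc (card X)"
      using finX by auto
    then show ?thesis using X w insert.hyps
      by (intro exI[of _ "insert w X"]) (auto simp: excess_def insert_absorb)
  next
    case 3
    then have "w' \<notin> X" using w by (metis imageI)
    then have "card (insert w (insert w' X)) = card X + 2"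
      using 3 w finX by simp
    moreover have "card (f ` insert w (insert w' X)) = card (f ` X) + 1"
      using 3 w finX by simp
    ultimately have "2 * card (f ` insert w (insert w' X)) + card Z
          \<le> card (insert w (insert w' X)) + 2 * card (f ` Z)"
        "excess f (insert w (insert w' X)) \<le> excess f Z + card (insert w W)"
      using X insert.hyps unfolding excess_def by auto
    then show ?thesis using X w
      by (intro exI[of _ "insert w (insert w' X)"]) auto
  qed
qed

text \<open>Dropping an element whose color is unique in \<open>U\<close> would keep the
  excess.\<close>

lemma smallest_subset_repeated:
  assumes fin: "finite E" and U: "U \<subseteq> E" "excess f U = excess f E"
    and min: "\<And>V. V \<subseteq> E \<Longrightarrow> excess f V = excess f E \<Longrightarrow> card U \<le> card V"
    and x: "x \<in> U"
  shows "\<exists>y\<in>U. y \<noteq> x \<and> f y = f x"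
proof (rule ccontr)
  assume "\<not> ?thesis"
  then have no: "f x \<notin> f ` (U - {x})" by force
  have finU: "finite U" using U fin finite_subset by blast
  have "f ` U = insert (f x) (f ` (U - {x}))" using x by blast
  then have "card (f ` U) = Suc (card (f ` (U - {x})))" using no finU by simp
  then have "excess f (U - {x}) = excess f U"
    using x finU by (simp add: excess_def)
  then have "card U \<le> card (U - {x})" using min[of "U - {x}"] U by auto
  then show False using x finU by (metis card_Diff1_less leD)
qed

text \<open>Here \<open>l\<close> and \<open>r\<close> stand for the two endpoint maps. Call size
  minus twice the number of colors the surplus; twice the excess is size plus surplus, so surplus
  \<open>d\<close> suffices at once. Otherwise a set of the largest attainable surplus
  \<open>h\<close> absorbs repeated elements that share endpoints, which make up the missing
  \<open>d - h\<close> on each side.\<close>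

lemma excess_seed:
  assumes fin: "finite E"
    and l: "card (l ` E) + d \<le> 2 * excess f E" and r: "card (r ` E) + d \<le> 2 * excess f E"
  shows "\<exists>X \<subseteq> E. excess f X \<le> 4 * d \<and> card (l ` X) + d \<le> 2 * excess f X
    \<and> card (r ` X) + d \<le> 2 * excess f X"
proof -
  define P where "P h \<longleftrightarrow> (\<exists>Z\<subseteq>E. 2 * card (f ` Z) + h \<le> card Z)" for h
  have dense: "\<exists>Z\<subseteq>E. card Z = 2 * card (f ` Z) + h \<and> excess f Z \<le> 2 * h" if "P h" for h
  proof -
    from that obtain Z where Z: "Z \<subseteq> E" "2 * card (f ` Z) + h \<le> card Z"
      unfolding P_def by blast
    then show ?thesis
      using dense_subset_small_excess[of Z f h] fin finite_subset by (metis subset_trans)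
  qed
  show ?thesis
  proof (cases "P d")
    case True
    then obtain Z where Z: "Z \<subseteq> E" "card Z = 2 * card (f ` Z) + d" "excess f Z \<le> 2 * d"
      using dense by blast
    have "finite Z" using Z fin finite_subset by blast
    then have "card (l ` Z) + d \<le> 2 * excess f Z" "card (r ` Z) + d \<le> 2 * excess f Z"
      using Z(2) card_image_le[of Z l] card_image_le[of Z r] by (simp_all add: excess_def)
    then show ?thesis using Z by (intro exI[of _ Z]) simp
  next
    case False
    have "P 0" unfolding P_def by (intro exI[of _ "{}"]) auto
    then obtain h where h: "h < d" "P h" "\<not> P (Suc h)"
      using False ex_least_nat_less[of "\<lambda>i. \<not> P i" d] by auto
    obtain Z where Z: "Z \<subseteq> E" "card Z = 2 * card (f ` Z) + h" "excess f Z \<le> 2 * h"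
      using dense[OF h(2)] by blast
    \<comment> \<open>A smallest \<open>U\<close> carrying all the excess has only repeated
      elements. Its surplus is at most \<open>h\<close>, which forces so many elements that both
      endpoint maps have excess at least \<open>d - h\<close> on it.\<close>
    obtain U where U: "U \<subseteq> E" "excess f U = excess f E"
      and min: "\<And>V. V \<subseteq> E \<Longrightarrow> excess f V = excess f E \<Longrightarrow> card U \<le> card V"
      using ex_has_least_nat[of "\<lambda>V. V \<subseteq> E \<and> excess f V = excess f E" E card] by auto
    have finU: "finite U" using U fin finite_subset by blast
    have repeated: "U \<subseteq> {x \<in> E. \<exists>y\<in>E. y \<noteq> x \<and> f y = f x}"
    proof
      fix x assume "x \<in> U"
      then obtain y where "y \<in> U" "y \<noteq> x" "f y = f x"
        using smallest_subset_repeated[OF fin U min] by metis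
      then show "x \<in> {x \<in> E. \<exists>y\<in>E. y \<noteq> x \<and> f y = f x}" using U(1) \<open>x \<in> U\<close> by blast
    qed
    have "\<not> 2 * card (f ` U) + Suc h \<le> card U"
      using h(3) U(1) unfolding P_def by blast
    then have U2: "2 * excess f E \<le> card U + h"
      using card_image_plus_excess[OF finU, of f] U(2) by linarith
    have "card (l ` U) \<le> card (l ` E)" "card (r ` U) \<le> card (r ` E)"
      using U fin by (auto intro: card_mono)
    then have "d - h \<le> excess l U" "d - h \<le> excess r U"
      using l r U2 h(1) by (simp_all add: excess_def)
    then obtain A B where A: "A \<subseteq> U" "excess l A = d - h" "card A \<le> 2 * (d - h)"
      and B: "B \<subseteq> U" "excess r B = d - h" "card B \<le> 2 * (d - h)"
      using excess_subset[OF finU] by metis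
    have "finite (A \<union> B)" using A B finU finite_subset by blast
    moreover have "A \<union> B \<subseteq> {x \<in> E. \<exists>y\<in>E. y \<noteq> x \<and> f y = f x}"
      using A(1) B(1) repeated by (meson Un_least order_trans)
    ultimately obtain X where X: "Z \<union> (A \<union> B) \<subseteq> X" "X \<subseteq> E"
        "2 * card (f ` X) + card Z \<le> card X + 2 * card (f ` Z)"
        "excess f X \<le> excess f Z + card (A \<union> B)"
      using absorb_repeated[OF fin Z(1), of "A \<union> B" f] by auto
    have finX: "finite X" using X fin finite_subset by blast
    \<comment> \<open>At most \<open>2 * h\<close> comes from \<open>Z\<close> and at most
      \<open>4 * (d - h)\<close> from \<open>A\<close> and \<open>B\<close>.\<close>
    have "excess f X \<le> 4 * d"
      using X(4) Z(3) A(3) B(3) card_Un_le[of A B] h(1) by linarith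
    moreover have dX: "card X + h \<le> 2 * excess f X"
      using X(3) Z(2) card_image_plus_excess[OF finX, of f] by linarith
    moreover have "d - h \<le> excess l X" "d - h \<le> excess r X"
      using excess_mono[OF finX, of A l] excess_mono[OF finX, of B r] X(1) A(2) B(2) by auto
    \<comment> \<open>Size plus \<open>h\<close> is at most twice the excess, and the vertices on a
      side number at most the size minus \<open>d - h\<close>.\<close>
    ultimately show ?thesis
      using X(2) card_image_plus_excess[OF finX, of l] card_image_plus_excess[OF finX, of r] h(1)
      by (intro exI[of _ X]) linarith
  qed
qed

text \<open>Growing the seed adds at most two vertices per side for each unit of excess, so the
  slack \<open>d\<close> survives. The bound \<open>4 * d \<le> e\<close> leaves room for the
  seed.\<close>

lemma excess_compact_subset:
  assumes fin: "finite E"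
    and l: "card (l ` E) + d \<le> 2 * excess f E" and r: "card (r ` E) + d \<le> 2 * excess f E"
    and e: "4 * d \<le> e" "e \<le> excess f E"
  shows "\<exists>X \<subseteq> E. excess f X = e \<and> card (l ` X) + d \<le> 2 * e \<and> card (r ` X) + d \<le> 2 * e"
proof -
  obtain X where X: "X \<subseteq> E" "excess f X \<le> 4 * d" "card (l ` X) + d \<le> 2 * excess f X"
    "card (r ` X) + d \<le> 2 * excess f X"
    using excess_seed[OF fin l r] by blast
  then obtain Y where Y: "X \<subseteq> Y" "Y \<subseteq> E" "excess f Y = e"
      "card Y + 2 * excess f X \<le> card X + 2 * e"
    using excess_extend[OF fin X(1), of f e] e by auto
  have "finite Y" using Y fin finite_subset by blast
  then show ?thesis
    using X Y card_image_le_superset[of Y X l] card_image_le_superset[of Y X r]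
    by (intro exI[of _ Y]) linarith
qed

section \<open>Complete bipartite graphs as grids, and their copies\<close>

text \<open>Edges become cells of a grid, so that a coloring is a function on pairs and
  \<open>fst\<close>, \<open>snd\<close> give the endpoints.\<close>

definition edge :: "nat \<times> nat \<Rightarrow> (nat + nat) set" where
  "edge p = {Inl (fst p), Inr (snd p)}"

lemma inj_edge: "inj edge"
  by (auto simp: inj_on_def edge_def doubleton_eq_iff prod_eq_iff)

lemma edges_complete_bipartite: "edges (complete_bipartite a b) = edge ` ({..<a} \<times> {..<b})"
  by (force simp: complete_bipartite_def edge_def)

lemma card_edges_complete_bipartite: "card (edges (complete_bipartite a b)) = a * b"
  unfolding edges_complete_bipartite
  by (subst card_image[OF inj_on_subset[OF inj_edge]]) auto

lemma simple_complete_bipartite: "simple_graph (complete_bipartite a b)"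
  by (auto simp: simple_graph_def complete_bipartite_def)

lemma card_edges_graph_iso:
  assumes "graph_iso F H" "simple_graph F"
  shows "card (edges F) = card (edges H)"
proof -
  obtain \<phi> where \<phi>: "inj_on \<phi> (verts F)" "edges H = (\<lambda>e. \<phi> ` e) ` edges F"
    using assms by (auto simp: graph_iso_def bij_betw_def)
  have "inj_on (\<lambda>e. \<phi> ` e) (edges F)"
    using assms(2) inj_on_image_Pow[OF \<phi>(1)]
    by (auto simp: simple_graph_def intro: inj_on_subset)
  then show ?thesis using \<phi>(2) by (simp add: card_image)
qed

text \<open>Supplies the copies on which the lower bound tests a coloring; relabeling each side
  gives the isomorphism.\<close>

lemma complete_bipartite_copy:
  assumes "S \<subseteq> {..<n}" "T \<subseteq> {..<n}"
  shows "\<exists>F. subgraph F (complete_bipartite n n)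
    \<and> graph_iso F (complete_bipartite (card S) (card T)) \<and> edges F = edge ` (S \<times> T)"
proof -
  have fin: "finite S" "finite T" using assms finite_subset by blast+
  obtain p where p: "bij_betw p S {..<card S}"
    using fin ex_bij_betw_finite_nat lessThan_atLeast0 by metis
  obtain q where q: "bij_betw q T {..<card T}"
    using fin ex_bij_betw_finite_nat lessThan_atLeast0 by metis
  define F where "F = (Inl ` S \<union> Inr ` T, edge ` (S \<times> T))"
  have "verts F \<subseteq> verts (complete_bipartite n n)"
    using assms by (auto simp: F_def complete_bipartite_def)
  moreover have "edges F \<subseteq> edges (complete_bipartite n n)"
    using assms by (auto simp: F_def edges_complete_bipartite)
  moreover have "simple_graph F"
    using fin by (auto simp: simple_graph_def F_def edge_def)
  ultimately have "subgraph F (complete_bipartite n n)" by (simp add: subgraph_def)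
  moreover have "graph_iso F (complete_bipartite (card S) (card T))"
    unfolding graph_iso_def
  proof (intro exI conjI)
    have "inj_on (map_sum p q) (verts F)"
      using p[THEN bij_betw_imp_inj_on] q[THEN bij_betw_imp_inj_on]
      by (auto simp: F_def intro!: inj_onI dest: inj_onD)
    moreover have "map_sum p q ` verts F = Inl ` p ` S \<union> Inr ` q ` T"
      by (simp add: F_def image_Un image_image)
    ultimately show "bij_betw (map_sum p q) (verts F) (verts (complete_bipartite (card S) (card T)))"
      using p q by (simp add: bij_betw_def complete_bipartite_def)
    have "(\<lambda>e. map_sum p q ` e) ` edges F = (\<lambda>x. edge (map_prod p q x)) ` (S \<times> T)"
      by (simp add: F_def image_image edge_def)
    also have "\<dots> = edge ` (p ` S \<times> q ` T)"
      by (simp only: image_image[symmetric] map_prod_surj_on[OF refl refl])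
    finally show "edges (complete_bipartite (card S) (card T)) = (\<lambda>e. map_sum p q ` e) ` edges F"
      using p q by (simp add: edges_complete_bipartite bij_betw_def)
  qed
  ultimately show ?thesis by (auto simp: F_def)
qed

text \<open>Diagonal edges form a matching, and each one in the copy contains a vertex of the part
  of size \<open>s\<close>. That part is located through the isomorphism, since the copy may sit
  either way round in the host.\<close>

lemma card_parallel_edges_copy_le:
  assumes F: "subgraph F (complete_bipartite n n)" "graph_iso F (complete_bipartite s t)"
  shows "card {a. edge (a, a) \<in> edges F} \<le> s"
proof -
  let ?Y = "{a. edge (a, a) \<in> edges F}"
  obtain \<phi> where \<phi>: "inj_on \<phi> (verts F)"
    "edges (complete_bipartite s t) = (\<lambda>e. \<phi> ` e) ` edges F"
    using F(2) by (auto simp: graph_iso_def bij_betw_def)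
  have "\<exists>i. i < s \<and> Inl i \<in> \<phi> ` edge (a, a)" if "a \<in> ?Y" for a
  proof -
    have "\<phi> ` edge (a, a) \<in> edge ` ({..<s} \<times> {..<t})"
      using that \<phi>(2) by (auto simp: edges_complete_bipartite)
    then show ?thesis by (auto simp: edge_def)
  qed
  then have "\<forall>a\<in>?Y. \<exists>i. i < s \<and> Inl i \<in> \<phi> ` edge (a, a)" by (rule ballI)
  then obtain i where i: "\<forall>a\<in>?Y. i a < s \<and> Inl (i a) \<in> \<phi> ` edge (a, a)"
    by (rule bchoice[THEN exE])
  have verts: "edge (a, a) \<subseteq> verts F" if "a \<in> ?Y" for a
    using that F(1) by (auto simp: subgraph_def simple_graph_def)
  have "inj_on i ?Y"
  proof (rule inj_onI)
    fix a b assume ab: "a \<in> ?Y" "b \<in> ?Y" "i a = i b"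
    have "Inl (i a) \<in> \<phi> ` edge (a, a) \<inter> \<phi> ` edge (b, b)"
      using bspec[OF i ab(1)] bspec[OF i ab(2)] ab(3) by (simp only: Int_iff)
    then have "\<phi> ` edge (a, a) \<inter> \<phi> ` edge (b, b) \<noteq> {}" by (metis empty_iff)
    then have "edge (a, a) \<inter> edge (b, b) \<noteq> {}"
      using inj_on_image_Int[OF \<phi>(1) verts[OF ab(1)] verts[OF ab(2)]] by auto
    then show "a = b" by (auto simp: edge_def)
  qed
  then have "card ?Y \<le> card {..<s}"
    using i by (intro card_inj_on_le[of i]) auto
  then show ?thesis by simp
qed

section \<open>From colorings to bounds on \<open>Hq_number\<close>\<close>

text \<open>Colors of any type are renumbered by \<open>h\<close>, so only their number has to be
  bounded.\<close>

lemma Hq_number_le: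
  assumes fin: "finite (edges G)" and card: "card (f ` edges G) \<le> c"
    and col: "\<And>F. subgraph F G \<Longrightarrow> graph_iso F H \<Longrightarrow> q \<le> card (f ` edges F)"
  shows "Hq_number G H q \<le> c"
  unfolding Hq_number_def
proof (rule Least_le)
  obtain h where h: "bij_betw h (f ` edges G) {..<card (f ` edges G)}"
    using fin ex_bij_betw_finite_nat[of "f ` edges G"] lessThan_atLeast0 by auto
  have "Hq_coloring G H q (h \<circ> f)"
    unfolding Hq_coloring_def
  proof (intro allI impI)
    fix F assume F: "subgraph F G \<and> graph_iso F H"
    then have "f ` edges F \<subseteq> f ` edges G" by (auto simp: subgraph_def)
    then have "card ((h \<circ> f) ` edges F) = card (f ` edges F)"
      using h unfolding image_comp[symmetric]
      by (intro card_image) (meson bij_betw_def inj_on_subset)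
    then show "q \<le> card ((h \<circ> f) ` edges F)" using F col by simp
  qed
  moreover have "(h \<circ> f) ` edges G \<subseteq> {..<c}"
    using h card unfolding image_comp[symmetric] bij_betw_def by auto
  ultimately show "\<exists>f :: 'a set \<Rightarrow> nat. f ` edges G \<subseteq> {..<c} \<and> Hq_coloring G H q f" by blast
qed

text \<open>Colors and excess of the grid add up to \<open>n\<^sup>2\<close>, so fewer than
  \<open>N\<close> colors mean large excess. A set of excess \<open>e\<close> on at most
  \<open>s\<close> vertices per side then fits into a copy, which is left with at most
  \<open>s * t - e\<close> colors.\<close>

lemma Hq_number_ge:
  assumes st: "0 < s" "s \<le> t" "t \<le> n" and e: "0 < e" "e \<le> s * t"
    and compact: "\<And>g :: nat \<times> nat \<Rightarrow> nat. N + excess g ({..<n} \<times> {..<n}) > n\<^sup>2 \<Longrightarrow>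
      \<exists>X \<subseteq> {..<n} \<times> {..<n}. excess g X = e \<and> card (fst ` X) \<le> s \<and> card (snd ` X) \<le> s"
  shows "N \<le> Hq_number (complete_bipartite n n) (complete_bipartite s t) (s * t - (e - 1))"
    (is "N \<le> ?c")
proof (rule ccontr)
  assume less: "\<not> N \<le> ?c"
  let ?E = "{..<n} \<times> {..<n}"
  obtain f :: "(nat + nat) set \<Rightarrow> nat" where f: "f ` edges (complete_bipartite n n) \<subseteq> {..<?c}"
    and col: "Hq_coloring (complete_bipartite n n) (complete_bipartite s t) (s * t - (e - 1)) f"
    using Hq_number_attained[OF simple_complete_bipartite, of "s * t - (e - 1)"
        "complete_bipartite s t" n n]
    by (auto simp: card_edges_complete_bipartite)
  define g where "g = f \<circ> edge"
  have "card (g ` ?E) \<le> card {..<?c}"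
    using f by (intro card_mono) (auto simp: g_def edges_complete_bipartite image_comp)
  then have "n\<^sup>2 < N + excess g ?E"
    using less card_image_plus_excess[of ?E g] by (simp add: power2_eq_square)
  then obtain X where X: "X \<subseteq> ?E" "excess g X = e" "card (fst ` X) \<le> s" "card (snd ` X) \<le> s"
    using compact by blast
  have "fst ` X \<subseteq> {..<n}" "snd ` X \<subseteq> {..<n}" using X(1) by auto
  then obtain S T where S: "fst ` X \<subseteq> S" "S \<subseteq> {..<n}" "card S = s"
    and T: "snd ` X \<subseteq> T" "T \<subseteq> {..<n}" "card T = t"
    using exists_subset_between[of "fst ` X" s "{..<n}"] exists_subset_between[of "snd ` X" t "{..<n}"]
      X st by auto
  obtain F where F: "subgraph F (complete_bipartite n n)" "graph_iso F (complete_bipartite s t)"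
      "edges F = edge ` (S \<times> T)"
    using complete_bipartite_copy[OF S(2) T(2)] S(3) T(3) by auto
  have "s * t - (e - 1) \<le> card (f ` edges F)"
    using col F unfolding Hq_coloring_def by blast
  also have "f ` edges F = g ` (S \<times> T)" by (simp add: F(3) g_def image_comp)
  finally have "s * t - (e - 1) \<le> card (g ` (S \<times> T))" .
  moreover have fin: "finite (S \<times> T)" using S(2) T(2) finite_subset by blast
  moreover have "e \<le> excess g (S \<times> T)"
    using excess_mono[OF fin, of X g] X(2) S(1) T(1) by force
  moreover have "card (S \<times> T) = s * t" using S(3) T(3) by (simp add: card_cartesian_product)
  ultimately show False using card_image_plus_excess[OF fin, of g] e by linarith
qed

text \<open>Excess \<open>e\<close> is reached by \<open>2 * e\<close> edges, which meet at most
  \<open>2 * e\<close> vertices on each side.\<close>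

lemma excess_grid_any_subset:
  assumes "2 * e \<le> s" "n\<^sup>2 < (n\<^sup>2 - (e - 1)) + excess g ({..<n} \<times> {..<n})" "e - 1 \<le> n\<^sup>2"
  shows "\<exists>X \<subseteq> {..<n} \<times> {..<n}. excess g X = e \<and> card (fst ` X) \<le> s \<and> card (snd ` X) \<le> s"
proof -
  obtain X where X: "X \<subseteq> {..<n} \<times> {..<n}" "excess g X = e" "card X \<le> 2 * e"
    using excess_subset[of "{..<n} \<times> {..<n}" e g] assms by fastforce
  have "finite X" using X(1) finite_subset by blast
  then have "card (fst ` X) \<le> card X" "card (snd ` X) \<le> card X" by (simp_all add: card_image_le)
  then show ?thesis using X assms(1) by (intro exI[of _ X]) linarith
qed

text \<open>The choice \<open>2 * e = s + d\<close> turns the vertex bound \<open>2 * e - d\<close>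
  into exactly \<open>s\<close>.\<close>

lemma excess_grid_compact:
  assumes "2 * e = s + d" "4 * d \<le> e" "e \<le> excess g ({..<n} \<times> {..<n})"
    "n + d \<le> 2 * excess g ({..<n} \<times> {..<n})"
  shows "\<exists>X \<subseteq> {..<n} \<times> {..<n}. excess g X = e \<and> card (fst ` X) \<le> s \<and> card (snd ` X) \<le> s"
proof -
  have "card (fst ` ({..<n} \<times> {..<n})) = n" "card (snd ` ({..<n} \<times> {..<n})) = n" by simp_all
  then obtain X where "X \<subseteq> {..<n} \<times> {..<n}" "excess g X = e"
    "card (fst ` X) + d \<le> 2 * e" "card (snd ` X) + d \<le> 2 * e"
    using excess_compact_subset[of "{..<n} \<times> {..<n}" fst d g snd e] assms by auto
  then show ?thesis using assms(1) by (intro exI[of _ X]) linarith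
qed

section \<open>Colorings for the upper bounds\<close>

text \<open>A coloring of total excess \<open>k\<close> will do: excess is monotone, so no copy
  loses more than \<open>k\<close> colors.\<close>

lemma Hq_number_le_few_repetitions:
  assumes "k < n\<^sup>2"
  shows "Hq_number (complete_bipartite n n) (complete_bipartite s t) (s * t - k) \<le> n\<^sup>2 - k"
proof -
  let ?G = "complete_bipartite n n"
  have fin: "finite (edges ?G)" by (simp add: edges_complete_bipartite)
  have cardG: "card (edges ?G) = n\<^sup>2"
    by (simp add: card_edges_complete_bipartite power2_eq_square)
  obtain h where h: "bij_betw h (edges ?G) {..<n\<^sup>2}"
    using ex_bij_betw_finite_nat[OF fin] cardG lessThan_atLeast0 by auto
  \<comment> \<open>The last \<open>k + 1\<close> edges of the enumeration share one color; all
    others keep their own.\<close>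
  define f where "f e = min (h e) (n\<^sup>2 - k - 1)" for e
  have "f ` edges ?G = (\<lambda>i. min i (n\<^sup>2 - k - 1)) ` {..<n\<^sup>2}"
    using h image_image[of "\<lambda>i. min i (n\<^sup>2 - k - 1)" h "edges ?G"]
    by (simp add: f_def bij_betw_def)
  also have "\<dots> = {..<n\<^sup>2 - k}"
  proof (intro equalityI subsetI)
    fix i assume "i \<in> {..<n\<^sup>2 - k}"
    then show "i \<in> (\<lambda>i. min i (n\<^sup>2 - k - 1)) ` {..<n\<^sup>2}"
      by (intro image_eqI[of _ _ i]) auto
  qed (use assms in auto)
  finally have f: "card (f ` edges ?G) = n\<^sup>2 - k" by simp
  show ?thesis
  proof (rule Hq_number_le[OF fin, of f])
    fix F assume F: "subgraph F ?G" "graph_iso F (complete_bipartite s t)"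
    then have "card (edges F) = s * t"
      using card_edges_graph_iso[OF F(2)] by (simp add: subgraph_def card_edges_complete_bipartite)
    moreover have sub: "edges F \<subseteq> edges ?G" using F by (simp add: subgraph_def)
    ultimately show "s * t - k \<le> card (f ` edges F)"
      using card_image_le_superset[OF fin sub, of f] f cardG assms by linarith
  qed (simp add: f)
qed

text \<open>The map \<open>g\<close> picks representatives: diagonal edges at \<open>a\<close> and
  \<open>g a\<close> share a color, and each edge off the diagonal has its own. A copy has at most
  \<open>s\<close> diagonal edges, so \<open>fibres\<close> bounds its loss by
  \<open>m\<close>.\<close>

lemma Hq_number_le_diagonal:
  assumes g: "\<And>a. a < n \<Longrightarrow> g a < n" "\<And>a. a < n \<Longrightarrow> g (g a) = g a"
    and fibres: "\<And>Y. Y \<subseteq> {..<n} \<Longrightarrow> card Y \<le> s \<Longrightarrow> card Y \<le> card (g ` Y) + m"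
  shows "Hq_number (complete_bipartite n n) (complete_bipartite s t) (s * t - m)
    \<le> n\<^sup>2 - card {a. a < n \<and> g a \<noteq> a}"
proof -
  let ?G = "complete_bipartite n n"
  let ?D = "{a. a < n \<and> g a \<noteq> a}"
  define \<rho> where "\<rho> p = (if fst p = snd p then (g (fst p), g (fst p)) else p)" for p :: "nat \<times> nat"
  define f where "f = \<rho> \<circ> inv edge"
  have f_edge: "f (edge p) = \<rho> p" for p by (simp add: f_def inj_edge)
  have fin: "finite (edges ?G)" by (simp add: edges_complete_bipartite)
  \<comment> \<open>Idempotence keeps \<open>(a, a)\<close> out of the image whenever
    \<open>g a \<noteq> a\<close>.\<close>
  have "f ` edges ?G \<subseteq> {..<n} \<times> {..<n} - (\<lambda>a. (a, a)) ` ?D"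
    using g by (auto simp: edges_complete_bipartite f_edge \<rho>_def split: if_splits)
  then have "card (f ` edges ?G) \<le> card ({..<n} \<times> {..<n} - (\<lambda>a. (a, a)) ` ?D)"
    by (intro card_mono) auto
  also have "\<dots> = n\<^sup>2 - card ((\<lambda>a. (a, a)) ` ?D)"
    by (subst card_Diff_subset) (auto simp: power2_eq_square)
  also have "card ((\<lambda>a. (a, a)) ` ?D) = card ?D"
    by (intro card_image) (auto simp: inj_on_def)
  finally have "card (f ` edges ?G) \<le> n\<^sup>2 - card ?D" .
  then show ?thesis
  proof (rule Hq_number_le[OF fin])
    fix F assume F: "subgraph F ?G" "graph_iso F (complete_bipartite s t)"
    define X where "X = {p. edge p \<in> edges F}"
    define Y where "Y = {a. edge (a, a) \<in> edges F}"
    define \<Delta> where "\<Delta> = (\<lambda>a. (a, a)) ` Y"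
    have sub: "edges F \<subseteq> edge ` ({..<n} \<times> {..<n})"
      using F by (simp add: subgraph_def edges_complete_bipartite)
    then have edgesF: "edges F = edge ` X" unfolding X_def by blast
    have X: "X \<subseteq> {..<n} \<times> {..<n}"
    proof
      fix p assume "p \<in> X"
      then have "edge p \<in> edge ` ({..<n} \<times> {..<n})" using sub unfolding X_def by blast
      then show "p \<in> {..<n} \<times> {..<n}" using inj_image_mem_iff[OF inj_edge] by blast
    qed
    then have Y: "Y \<subseteq> {..<n}" unfolding X_def Y_def by auto
    have finX: "finite X" and finY: "finite Y" using X Y finite_subset by blast+
    have \<Delta>: "\<Delta> \<subseteq> X" "card \<Delta> = card Y"
      unfolding \<Delta>_def by (auto simp: X_def Y_def inj_on_def intro!: card_image)
    have "card X = card (edges F)"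
      unfolding edgesF by (metis card_image inj_edge inj_on_subset subset_UNIV)
    also have "\<dots> = s * t"
      using F card_edges_graph_iso[OF F(2)]
      by (simp add: subgraph_def card_edges_complete_bipartite)
    finally have cardX: "card X = s * t" .
    \<comment> \<open>Only the diagonal part can collapse; its colors stay on the diagonal, disjoint
      from the fixed rest.\<close>
    have "\<rho> ` X = (X - \<Delta>) \<union> (\<lambda>a. (a, a)) ` g ` Y"
    proof -
      have "\<rho> ` \<Delta> = (\<lambda>a. (a, a)) ` g ` Y" 
        unfolding \<Delta>_def image_image by (simp add: \<rho>_def)
      moreover have "\<rho> p = p" if "p \<in> X - \<Delta>" for p
        using that by (cases p) (auto simp: \<rho>_def \<Delta>_def X_def Y_def)
      then have "\<rho> ` (X - \<Delta>) = X - \<Delta>" by force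
      moreover have "X = (X - \<Delta>) \<union> \<Delta>" using \<Delta> by blast
      ultimately show ?thesis by (metis image_Un)
    qed
    moreover have "(X - \<Delta>) \<inter> (\<lambda>a. (a, a)) ` g ` Y = {}"
      by (auto simp: \<Delta>_def X_def Y_def)
    moreover have "card ((\<lambda>a. (a, a)) ` g ` Y) = card (g ` Y)"
      by (intro card_image) (auto simp: inj_on_def)
    ultimately have "card (\<rho> ` X) = card (X - \<Delta>) + card (g ` Y)"
      using finX finY by (simp add: card_Un_disjoint)
    moreover have "card (X - \<Delta>) + card \<Delta> = card X"
      using \<Delta> finX by (metis card_Diff_subset card_mono finite_subset le_add_diff_inverse2)
    moreover have "card Y \<le> card (g ` Y) + m"
      using fibres Y card_parallel_edges_copy_le[OF F] by (simp add: Y_def)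
    moreover have "f ` edges F = \<rho> ` X" by (simp add: edgesF image_image f_edge)
    ultimately show "s * t - m \<le> card (f ` edges F)" using \<Delta>(2) cardX by simp
  qed
qed

lemma card_odd_lessThan: "card {a::nat. a < n \<and> odd a} = n div 2"
proof -
  have "{a. a < n \<and> odd a} = (\<lambda>i. 2 * i + 1) ` {..<n div 2}"
    by (auto elim!: oddE)
  then show ?thesis by (simp add: card_image inj_on_def)
qed

lemma card_le_image_div2:
  fixes Y :: "nat set"
  assumes "finite Y"
  shows "card Y \<le> 2 * card ((\<lambda>a. 2 * (a div 2)) ` Y)"
proof -
  let ?g = "\<lambda>a::nat. 2 * (a div 2)"
  have "card {x \<in> Y. ?g x = c} \<le> 2" for c
  proof -
    have "{x \<in> Y. ?g x = c} \<subseteq> {c, c + 1}" by auto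
    then have "card {x \<in> Y. ?g x = c} \<le> card {c, c + 1}" by (intro card_mono) auto
    then show ?thesis by simp
  qed
  then have "(\<Sum>c\<in>?g ` Y. card {x \<in> Y. ?g x = c}) \<le> (\<Sum>c\<in>?g ` Y. 2)"
    by (intro sum_mono)
  then show ?thesis using card_eq_sum_fibres[OF assms, of ?g] by simp
qed

text \<open>The indices \<open>2 * j\<close> and \<open>2 * j + 1\<close> are merged, so each odd
  index loses its color, and any set of diagonal edges keeps at least half as many colors.\<close>

lemma Hq_number_le_pairs:
  "Hq_number (complete_bipartite n n) (complete_bipartite s t) (s * t - s div 2) \<le> n\<^sup>2 - n div 2"
proof -
  let ?g = "\<lambda>a::nat. 2 * (a div 2)"
  have "{a. a < n \<and> ?g a \<noteq> a} = {a. a < n \<and> odd a}" by (auto elim!: evenE oddE)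
  moreover have "Hq_number (complete_bipartite n n) (complete_bipartite s t) (s * t - s div 2)
      \<le> n\<^sup>2 - card {a. a < n \<and> ?g a \<noteq> a}"
  proof (rule Hq_number_le_diagonal)
    fix Y assume "Y \<subseteq> {..<n}" "card Y \<le> s"
    then show "card Y \<le> card (?g ` Y) + s div 2"
      using card_le_image_div2[of Y] finite_subset[of Y] by fastforce
  qed auto
  ultimately show ?thesis by (simp add: card_odd_lessThan)
qed

text \<open>For odd \<open>n\<close> the index \<open>n - 1\<close> has no partner; joining it to
  the pair \<open>n - 3\<close>, \<open>n - 2\<close> saves one more color.\<close>

lemma Hq_number_le_pairs_and_triple:
  assumes "even s" "odd n" "3 \<le> n"
  shows "Hq_number (complete_bipartite n n) (complete_bipartite s t) (s * t - s div 2)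
    \<le> n\<^sup>2 - (n + 1) div 2"
proof -
  define g where "g a = (if a = n - 1 then n - 3 else 2 * (a div 2))" for a
  have "{a. a < n \<and> g a \<noteq> a} = insert (n - 1) {a. a < n \<and> odd a}"
    using assms by (auto simp: g_def elim!: oddE)
  then have "card {a. a < n \<and> g a \<noteq> a} = (n + 1) div 2"
    using assms by (simp add: card_odd_lessThan)
  moreover have "Hq_number (complete_bipartite n n) (complete_bipartite s t) (s * t - s div 2)
      \<le> n\<^sup>2 - card {a. a < n \<and> g a \<noteq> a}"
  proof (rule Hq_number_le_diagonal)
    show "g a < n" if "a < n" for a using that assms by (auto simp: g_def)
    show "g (g a) = g a" if "a < n" for a
    proof -
      have "2 * (a div 2) \<noteq> n - 1" if "a \<noteq> n - 1" using that \<open>a < n\<close> by linarith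
      moreover have "2 * ((n - 3) div 2) = n - 3" "n - 3 \<noteq> n - 1" using assms by auto
      ultimately show ?thesis by (simp add: g_def)
    qed
    fix Y assume Y: "Y \<subseteq> {..<n}" "card Y \<le> s"
    have fin: "finite Y" using Y finite_subset by blast
    let ?Y = "Y - {n - 1}"
    have "card ?Y \<le> 2 * card ((\<lambda>a. 2 * (a div 2)) ` ?Y)"
      using fin by (intro card_le_image_div2) auto
    also have "(\<lambda>a. 2 * (a div 2)) ` ?Y = g ` ?Y"
      by (intro image_cong) (auto simp: g_def)
    also have "card (g ` ?Y) \<le> card (g ` Y)" using fin by (intro card_mono) auto
    finally have "card Y \<le> 2 * card (g ` Y) + 1" using fin card_Diff1_le
      by (simp add: card_Diff_singleton_if split: if_splits)
    \<comment> \<open>The extra one matters only for odd \<open>card Y\<close>, and then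
      \<open>card Y < s\<close> because \<open>s\<close> is even.\<close>
    then show "card Y \<le> card (g ` Y) + s div 2" using Y(2) assms(1) by (auto elim!: evenE)
  qed
  ultimately show ?thesis by simp
qed

section \<open>Matching the bounds for large \<open>n\<close>\<close>

theorem theoremB1:
  fixes s t k :: nat
  assumes "2 \<le> s" and "s \<le> t" and "k \<le> s div 2 - 1"
  shows "\<forall>\<^sub>F n in sequentially.
      Hq_number (complete_bipartite n n) (complete_bipartite s t) (s * t - k) = n\<^sup>2 - k
    \<and> Hq_number (complete_bipartite n n) (complete_bipartite s t) (s * t - s div 2)
        \<le> n\<^sup>2 - n div 2
    \<and> (7 \<le> s \<and> odd s \<longrightarrow>
        Hq_number (complete_bipartite n n) (complete_bipartite s t) (s * t - s div 2)
          = n\<^sup>2 - n div 2)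
    \<and> (14 \<le> s \<and> even s \<longrightarrow>
        Hq_number (complete_bipartite n n) (complete_bipartite s t) (s * t - s div 2)
          = n\<^sup>2 - (n + 1) div 2)"
proof (rule eventually_sequentiallyI[of "2 * (s + t)"])
  \<comment> \<open>The threshold gives \<open>t \<le> n\<close>, and it makes a total excess of at
    least \<open>n / 2\<close> exceed \<open>s div 2\<close>.\<close>
  fix n assume n: "2 * (s + t) \<le> n"
  let ?r = "\<lambda>m. Hq_number (complete_bipartite n n) (complete_bipartite s t) (s * t - m)"
  have sq: "n \<le> n\<^sup>2" by (simp add: power2_eq_square)
  have "2 * s \<le> s * t" using assms by (metis mult.commute mult_le_mono2 order_trans)
  then have e_le: "Suc k \<le> s * t" "Suc (s div 2) \<le> s * t" using assms by linarith+
  \<comment> \<open>The first equation forces \<open>d = 1\<close> for odd \<open>s\<close> and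
    \<open>d = 2\<close> for even \<open>s\<close>. The seed condition
    \<open>4 * d \<le> Suc (s div 2)\<close> then reads \<open>7 \<le> s\<close> or
    \<open>14 \<le> s\<close>, which is where these thresholds come from.\<close>
  have lower: "n\<^sup>2 - (n + d - 1) div 2 \<le> ?r (s div 2)"
    if d: "2 * Suc (s div 2) = s + d" "4 * d \<le> Suc (s div 2)" "1 \<le> d" "d \<le> 2" for d
  proof -
    have "n\<^sup>2 - (n + d - 1) div 2 \<le> ?r (Suc (s div 2) - 1)"
    proof (rule Hq_number_ge)
      fix g :: "nat \<times> nat \<Rightarrow> nat"
      assume "n\<^sup>2 < n\<^sup>2 - (n + d - 1) div 2 + excess g ({..<n} \<times> {..<n})"
      \<comment> \<open>Subtraction is truncated, so this step uses
        \<open>(n + d - 1) div 2 \<le> n\<^sup>2\<close>.\<close>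
      then have "(n + d - 1) div 2 < excess g ({..<n} \<times> {..<n})"
        using sq n d(3,4) assms(1) by linarith
      then have "n + d - 1 < excess g ({..<n} \<times> {..<n}) * 2"
        by (simp add: div_less_iff_less_mult)
      then have x: "n + d \<le> 2 * excess g ({..<n} \<times> {..<n})" by linarith
      then have "Suc (s div 2) \<le> excess g ({..<n} \<times> {..<n})"
        using n d(1,4) assms(1) by arith
      then show "\<exists>X \<subseteq> {..<n} \<times> {..<n}. excess g X = Suc (s div 2)
          \<and> card (fst ` X) \<le> s \<and> card (snd ` X) \<le> s"
        using d x by (intro excess_grid_compact[of _ _ d]) auto
    qed (use assms n e_le in auto)
    then show ?thesis by simp
  qed
  have "n\<^sup>2 - k \<le> ?r k"
  proof -
    have "n\<^sup>2 - k \<le> ?r (Suc k - 1)"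
    proof (rule Hq_number_ge)
      fix g :: "nat \<times> nat \<Rightarrow> nat"
      assume "n\<^sup>2 < n\<^sup>2 - k + excess g ({..<n} \<times> {..<n})"
      then show "\<exists>X \<subseteq> {..<n} \<times> {..<n}. excess g X = Suc k \<and> card (fst ` X) \<le> s \<and> card (snd ` X) \<le> s"
        using assms n sq by (intro excess_grid_any_subset) auto
    qed (use assms n e_le in auto)
    then show ?thesis by simp
  qed
  moreover have "?r k \<le> n\<^sup>2 - k"
    using assms n sq by (intro Hq_number_le_few_repetitions) simp
  moreover have "?r (s div 2) \<le> n\<^sup>2 - n div 2" by (rule Hq_number_le_pairs)
  moreover have "n\<^sup>2 - n div 2 \<le> ?r (s div 2)" if "7 \<le> s" "odd s"
    using lower[of 1] that by (auto elim!: oddE)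
  moreover have "n\<^sup>2 - (n + 1) div 2 \<le> ?r (s div 2)" if "14 \<le> s" "even s"
    using lower[of 2] that by (auto elim!: evenE)
  \<comment> \<open>For even \<open>n\<close> both roundings of \<open>n / 2\<close> agree and pairs
    suffice; odd \<open>n\<close> calls for the triple.\<close>
  moreover have "?r (s div 2) \<le> n\<^sup>2 - (n + 1) div 2" if "even s"
  proof (cases "even n")
    case True
    then show ?thesis using Hq_number_le_pairs[of n s t] by simp
  next
    case False
    then show ?thesis using that assms n by (intro Hq_number_le_pairs_and_triple) auto
  qed
  ultimately show "?r k = n\<^sup>2 - k \<and> ?r (s div 2) \<le> n\<^sup>2 - n div 2
    \<and> (7 \<le> s \<and> odd s \<longrightarrow> ?r (s div 2) = n\<^sup>2 - n div 2)
    \<and> (14 \<le> s \<and> even s \<longrightarrow> ?r (s div 2) = n\<^sup>2 - (n + 1) div 2)"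
    by (auto intro: antisym)
qed

end
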